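(* Let $(\beta,\alpha)\in\Delta$. The dimension function $\eta_{\beta,\alpha}\colon t\mapsto\dim_{\mathcal{H}}(K^{+}_{\beta,\alpha}(t))$ is a Devil's staircase function, that is, $\eta_{\beta,\alpha}(0)=1$, $\eta_{\beta,\alpha}((1-\alpha)/\beta)=0$, $\eta_{\beta,\alpha}$ is decreasing (in the weak sense), and $\eta_{\beta,\alpha}$ is locally constant Lebesgue almost everywhere (i.e. Lebesgue almost every $t$ has a neighbourhood on which $\eta_{\beta,\alpha}$ is constant).
   Context: $\mathbb{N}_0=\{0,1,2,\dots\}$. $\Delta=\{(b,a)\in\mathbb{R}^2\colon b\in(1,2),\ a\in[0,2-b]\}$. For $(\beta,\alpha)\in\Delta$, $T_{\beta,\alpha}\colon[0,1]\to[0,1]$, $T_{\beta,\alpha}(x)=\beta x+\alpha\bmod 1$. For $t\in[0,1]$ the survivor set is $$K^{+}_{\beta,\alpha}(t)=\{x\in[0,1)\colon T_{\beta,\alpha}^{n}(x)\notin[0,t)\text{ for all }n\in\mathbb{N}_0\}.$$ $\dim_{\mathcal{H}}$ denotes Hausdorff dimension. *)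

theory Defs
  imports "HOL-Analysis.Analysis"
begin

text \<open>Hausdorff measure and Hausdorff dimension in a metric space.\<close>

text \<open>The \<open>s\<close>-th power of the diameter of a covering set. The exponent \<open>0\<close> is treated separately
  because \<open>0 powr 0 = 0\<close>; as usual, a nonempty set contributes \<open>1\<close> in that case and the
  empty set contributes \<open>0\<close> for every exponent.\<close>

definition diam_power :: "real \<Rightarrow> 'a::metric_space set \<Rightarrow> ennreal" where
  "diam_power s U =
     (if U = {} then 0 else if s = 0 then 1 else ennreal (diameter U powr s))"

text \<open>Boundedness is required explicitly since \<^const>\<open>diameter\<close> is real-valued and carries no
  information for unbounded sets. Finite covers are included, as some \<open>U i\<close> may be empty;
  if there is no countable \<open>\<delta>\<close>-cover the infimum is \<open>\<infinity>\<close>.\<close>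

definition hausdorff_premeasure :: "real \<Rightarrow> real \<Rightarrow> 'a::metric_space set \<Rightarrow> ennreal" where
  "hausdorff_premeasure s \<delta> A =
     (INF U \<in> {U :: nat \<Rightarrow> 'a set.
                 A \<subseteq> (\<Union>i. U i) \<and> (\<forall>i. bounded (U i) \<and> diameter (U i) \<le> \<delta>)}.
        (\<Sum>i. diam_power s (U i)))"

definition hausdorff_measure :: "real \<Rightarrow> 'a::metric_space set \<Rightarrow> ennreal" where
  "hausdorff_measure s A = (SUP \<delta> \<in> {0<..}. hausdorff_premeasure s \<delta> A)"

text \<open>With this definition the empty set has dimension \<open>0\<close>.\<close>

definition hausdorff_dim :: "'a::metric_space set \<Rightarrow> ennreal" where
  "hausdorff_dim A = (INF s \<in> {s. 0 \<le> s \<and> hausdorff_measure s A = 0}. ennreal s)"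

definition Delta :: "(real \<times> real) set" where
  "Delta = {(b, a). b \<in> {1<..<2} \<and> a \<in> {0..2 - b}}"

definition beta_map :: "real \<Rightarrow> real \<Rightarrow> real \<Rightarrow> real" where
  "beta_map \<beta> \<alpha> x = frac (\<beta> * x + \<alpha>)"

definition survivor_set :: "real \<Rightarrow> real \<Rightarrow> real \<Rightarrow> real set" where
  "survivor_set \<beta> \<alpha> t = {x \<in> {0..<1}. \<forall>n::nat. (beta_map \<beta> \<alpha> ^^ n) x \<notin> {0..<t}}"

definition dim_fun :: "real \<Rightarrow> real \<Rightarrow> real \<Rightarrow> ennreal" where
  "dim_fun \<beta> \<alpha> t = hausdorff_dim (survivor_set \<beta> \<alpha> t)"

text \<open>A function on \<open>[0,1]\<close>; neighbourhoods are taken relative to \<open>[0,1]\<close>.\<close>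

definition locally_constant_at :: "(real \<Rightarrow> 'b) \<Rightarrow> real \<Rightarrow> bool" where
  "locally_constant_at f t \<longleftrightarrow>
     (\<exists>U. open U \<and> t \<in> U \<and> (\<forall>s \<in> U \<inter> {0..1}. f s = f t))"

end

theory Submission imports Defs begin

text \<open>If the orbit of \<open>t\<close> enters \<open>[0, t)\<close>, and does so along a continuity point of the iterate, then
  the survivor set itself is constant near \<open>t\<close>, and so is its dimension. Every \<open>t > 0\<close> whose orbit
  never enters \<open>[0, t)\<close> lies in the survivor set of some rational \<open>q > 0\<close>, so it suffices that
  these survivor sets are Lebesgue null. This holds because in every interval the proportion of
  points that fall into the hole \<open>[0, q)\<close> is at least \<open>q\<close>.\<close>

section \<open>Hausdorff dimension\<close>

lemma hausdorff_measure_mono: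
  assumes "A \<subseteq> B"
  shows "hausdorff_measure s A \<le> hausdorff_measure s B"
  unfolding hausdorff_measure_def hausdorff_premeasure_def
  by (intro SUP_mono' INF_superset_mono) (use assms in auto)

lemma hausdorff_dim_mono:
  assumes "A \<subseteq> B"
  shows "hausdorff_dim A \<le> hausdorff_dim B"
  unfolding hausdorff_dim_def
proof (rule INF_superset_mono)
  show "{s. 0 \<le> s \<and> hausdorff_measure s B = 0} \<subseteq> {s. 0 \<le> s \<and> hausdorff_measure s A = 0}"
    using hausdorff_measure_mono[OF assms] by (metis (mono_tags, lifting) Collect_mono le_zero_eq)
qed simp

text \<open>Even the exponent 0 is admissible, since empty covering sets cost nothing. This gives
  the dimension at \<open>(1 - \<alpha>) / \<beta>\<close>, where no point survives.\<close>

lemma hausdorff_dim_empty [simp]: "hausdorff_dim ({} :: 'a::metric_space set) = 0"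
proof -
  have "hausdorff_premeasure 0 \<delta> ({} :: 'a set) = 0" if "\<delta> > 0" for \<delta>
  proof -
    have "hausdorff_premeasure 0 \<delta> ({} :: 'a set) \<le> (\<Sum>i::nat. diam_power 0 ({} :: 'a set))"
      unfolding hausdorff_premeasure_def using that by (intro INF_lower) auto
    then show ?thesis by (simp add: diam_power_def)
  qed
  then have "hausdorff_measure 0 ({} :: 'a set) = 0"
    by (simp add: hausdorff_measure_def)
  then have "hausdorff_dim ({} :: 'a set) \<le> ennreal 0"
    unfolding hausdorff_dim_def by (intro INF_lower) auto
  then show ?thesis by simp
qed

text \<open>A covering set need not be measurable, so it is enclosed in the closed interval of
  radius \<open>diameter U\<close> around one of its points. For diameter at most 1 and exponent
  below 1, the diameter is at most its own power.\<close>

lemma emeasure_le_diam_power: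
  fixes U :: "real set"
  assumes "bounded U" "diameter U \<le> 1" "0 \<le> s" "s < 1"
  obtains J where "J \<in> sets lborel" "U \<subseteq> J" "emeasure lborel J \<le> 2 * diam_power s U"
proof (cases "U = {}")
  case True
  with that[of "{}"] show ?thesis by simp
next
  case False
  then obtain x where x: "x \<in> U" by auto
  define d where "d = diameter U"
  have d: "0 \<le> d" "d \<le> 1" using assms diameter_ge_0 by (auto simp: d_def)
  have "d \<le> d powr s" if "s \<noteq> 0"
    using d assms powr_mono'[of s 1 d] that by (cases "d = 0") auto
  then have le: "ennreal d \<le> diam_power s U"
    using False d by (auto simp: diam_power_def d_def[symmetric] ennreal_leI intro: ennreal_le_1[THEN iffD2])
  show ?thesis
  proof (rule that[of "{x - d..x + d}"])
    show "U \<subseteq> {x - d..x + d}"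
      using diameter_bounded_bound[OF assms(1) x] by (auto simp: d_def dist_real_def abs_le_iff algebra_simps)
    have "emeasure lborel {x - d..x + d} = 2 * ennreal d"
      using d by (simp add: ennreal_mult' flip: ennreal_numeral)
    also have "\<dots> \<le> 2 * diam_power s U" by (intro mult_left_mono le) auto
    finally show "emeasure lborel {x - d..x + d} \<le> 2 * diam_power s U" .
  qed auto
qed

text \<open>Countable subadditivity of Lebesgue measure shows that every cover by sets of diameter
  at most 1 costs at least 1/2. The single scale 1 is enough, because the Hausdorff measure is a
  supremum over scales.\<close>

lemma hausdorff_measure_unit_interval_pos:
  assumes "0 \<le> s" "s < 1"
  shows "hausdorff_measure s {0..<1::real} \<noteq> 0"
proof -
  have "1 \<le> 2 * (\<Sum>i. diam_power s (U i))"
    if U: "{0..<1} \<subseteq> (\<Union>i. U i)" "\<forall>i. bounded (U i) \<and> diameter (U i) \<le> 1"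
    for U :: "nat \<Rightarrow> real set"
  proof -
    have "\<exists>J. J \<in> sets lborel \<and> U i \<subseteq> J \<and> emeasure lborel J \<le> 2 * diam_power s (U i)" for i
      using emeasure_le_diam_power[of "U i" s] assms U(2) by metis
    then obtain J where J: "\<And>i. J i \<in> sets lborel" "\<And>i. U i \<subseteq> J i"
        "\<And>i. emeasure lborel (J i) \<le> 2 * diam_power s (U i)" by metis
    have "1 = emeasure lborel {0..<1::real}" by simp
    also have "\<dots> \<le> emeasure lborel (\<Union>i. J i)"
      using U(1) J(1,2) by (intro emeasure_mono sets.countable_UN) (blast, auto)
    also have "\<dots> \<le> (\<Sum>i. emeasure lborel (J i))"
      using J(1) by (intro emeasure_subadditive_countably) auto
    also have "\<dots> \<le> (\<Sum>i. 2 * diam_power s (U i))" by (intro suminf_le J) auto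
    finally show ?thesis by simp
  qed
  then have "1 / 2 \<le> (\<Sum>i. diam_power s (U i))"
    if "{0..<1} \<subseteq> (\<Union>i. U i)" "\<forall>i. bounded (U i) \<and> diameter (U i) \<le> 1"
    for U :: "nat \<Rightarrow> real set"
    using that by (subst divide_le_posI_ennreal) (auto simp: mult.commute)
  then have "1 / 2 \<le> hausdorff_premeasure s 1 {0..<1::real}"
    unfolding hausdorff_premeasure_def by (intro INF_greatest) auto
  also have "\<dots> \<le> hausdorff_measure s {0..<1::real}"
    unfolding hausdorff_measure_def by (intro SUP_upper) auto
  finally show ?thesis by (auto simp: ennreal_divide_eq_0_iff)
qed

text \<open>Covering by \<open>N\<close> intervals of length \<open>1 / N\<close> costs
  \<open>N powr (1 - s)\<close>, which tends to 0 for \<open>s > 1\<close>.\<close>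

lemma hausdorff_measure_unit_interval_zero:
  assumes "1 < s"
  shows "hausdorff_measure s {0..<1::real} = 0"
proof -
  have "hausdorff_premeasure s \<delta> {0..<1::real} \<le> 0" if \<delta>: "\<delta> > 0" for \<delta>
  proof (rule tendsto_lowerbound)
    have "(\<lambda>N. real N powr (1 - s)) \<longlonglongrightarrow> 0"
      using assms by (intro tendsto_neg_powr filterlim_real_sequentially) auto
    then show "(\<lambda>N. ennreal (real N powr (1 - s))) \<longlonglongrightarrow> 0"
      using tendsto_ennrealI by fastforce
    have "\<forall>\<^sub>F N in sequentially. 1 / \<delta> < real N"
      using filterlim_real_sequentially by (simp add: filterlim_at_top_dense)
    then show "\<forall>\<^sub>F N in sequentially.
        hausdorff_premeasure s \<delta> {0..<1::real} \<le> ennreal (real N powr (1 - s))"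
    proof eventually_elim
      case (elim N)
      have "0 < 1 / \<delta>" using \<delta> by simp
      with elim have N: "real N > 0" by linarith
      have small: "1 / real N \<le> \<delta>" using elim N \<delta> by (simp add: field_simps)
      \<comment> \<open>A cover is an infinite sequence; its entries from \<open>N\<close> on are
        empty and cost nothing.\<close>
      define U where "U i = (if i < N then {real i / N..(real i + 1) / N} else {})" for i
      have diam: "diameter {real i / N..(real i + 1) / N} = 1 / N" for i
        using N by (subst diameter_closed_interval) (auto simp: field_simps)
      have "x \<in> (\<Union>i. U i)" if "x \<in> {0..<1}" for x
      proof -
        define i where "i = nat \<lfloor>x * N\<rfloor>"
        have *: "real i \<le> x * N" "x * N < real i + 1" using that N unfolding i_def by auto
        have "x * real N < 1 * real N" using that N by (intro mult_strict_right_mono) auto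
        then have "i < N" using * by linarith
        moreover have "x \<in> {real i / N..(real i + 1) / N}" using * N by (simp add: field_simps)
        ultimately show ?thesis by (auto simp: U_def)
      qed
      then have "hausdorff_premeasure s \<delta> {0..<1::real} \<le> (\<Sum>i. diam_power s (U i))"
        unfolding hausdorff_premeasure_def
        using small diam \<delta> by (intro INF_lower) (auto simp: U_def)
      also have "\<dots> = (\<Sum>i<N. diam_power s (U i))"
        by (rule suminf_finite) (auto simp: U_def diam_power_def)
      also have "\<dots> = (\<Sum>i<N. ennreal ((1 / N) powr s))"
      proof (rule sum.cong)
        fix i assume "i \<in> {..<N}"
        then have "U i = {real i / N..(real i + 1) / N}" by (simp add: U_def)
        moreover have "U i \<noteq> {}" unfolding calculation using N by (simp add: divide_right_mono)
        ultimately show "diam_power s (U i) = ennreal ((1 / N) powr s)"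
          using assms diam[of i] by (simp only: diam_power_def) simp
      qed simp
      also have "\<dots> = ennreal (N * (1 / N) powr s)"
        by (simp add: ennreal_mult' ennreal_of_nat_eq_real_of_nat)
      also have "N * (1 / N) powr s = N powr (1 - s)"
        using N by (simp add: powr_diff powr_divide)
      finally show ?case .
    qed
  qed simp
  then show ?thesis by (simp add: hausdorff_measure_def)
qed

lemma hausdorff_dim_unit_interval: "hausdorff_dim {0..<1::real} = 1"
proof (rule antisym)
  \<comment> \<open>The measure is known to vanish only for exponents strictly above 1, so the upper
    bound is approached from above.\<close>
  have "hausdorff_dim {0..<1::real} \<le> 1 + ennreal e" if "e > 0" for e
  proof -
    have "hausdorff_dim {0..<1::real} \<le> ennreal (1 + e)"
      unfolding hausdorff_dim_def
      using hausdorff_measure_unit_interval_zero[of "1 + e"] that by (intro INF_lower) auto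
    then show ?thesis using that by simp
  qed
  then show "hausdorff_dim {0..<1::real} \<le> 1"
    by (rule ennreal_le_epsilon) simp
  show "1 \<le> hausdorff_dim {0..<1::real}"
    unfolding hausdorff_dim_def
  proof (rule INF_greatest)
    fix s assume "s \<in> {s. 0 \<le> s \<and> hausdorff_measure s {0..<1::real} = 0}"
    with hausdorff_measure_unit_interval_pos[of s] have "1 \<le> s" by force
    then show "1 \<le> ennreal s" by simp
  qed
qed

section \<open>Survivor sets\<close>

lemma survivor_set_antimono: "s \<le> t \<Longrightarrow> survivor_set \<beta> \<alpha> t \<subseteq> survivor_set \<beta> \<alpha> s"
  by (fastforce simp: survivor_set_def)

lemma beta_map_bounds: "0 \<le> beta_map \<beta> \<alpha> x" "beta_map \<beta> \<alpha> x < 1"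
  by (auto simp: beta_map_def frac_lt_1)

lemma funpow_beta_map_bounds:
  assumes "x \<in> {0..<1}"
  shows "(beta_map \<beta> \<alpha> ^^ n) x \<in> {0..<1}"
  using assms by (cases n) (auto simp: beta_map_bounds)

lemma survivor_set_iff:
  "x \<in> survivor_set \<beta> \<alpha> t \<longleftrightarrow> x \<in> {0..<1} \<and> (\<forall>n. t \<le> (beta_map \<beta> \<alpha> ^^ n) x)"
  using funpow_beta_map_bounds[of x _ \<beta> \<alpha>] by (auto simp: survivor_set_def not_less)

lemma survivor_set_zero: "survivor_set \<beta> \<alpha> 0 = {0..<1}"
  by (auto simp: survivor_set_def)

lemma measurable_beta_map [measurable]: "beta_map \<beta> \<alpha> \<in> borel_measurable borel"
  unfolding beta_map_def frac_def by measurable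

lemma measurable_funpow_beta_map [measurable]: "beta_map \<beta> \<alpha> ^^ n \<in> borel_measurable borel"
  by (induction n) (auto simp: measurable_beta_map intro: measurable_comp)

lemma sets_survivor_set [measurable]: "survivor_set \<beta> \<alpha> t \<in> sets borel"
proof -
  have "survivor_set \<beta> \<alpha> t = {0..<1} \<inter> (\<Inter>n. (beta_map \<beta> \<alpha> ^^ n) -` {t..})"
    by (auto simp: survivor_set_iff)
  moreover have "(beta_map \<beta> \<alpha> ^^ n) -` {t..} \<in> sets borel" for n
    using measurable_sets[OF measurable_funpow_beta_map[of n \<beta> \<alpha>], of "{t..}"] by simp
  ultimately show ?thesis by (auto intro: sets.countable_INT)
qed

text \<open>Some neighbourhood of \<open>t\<close> is mapped below itself, so no surviving orbit can enter it.\<close>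

lemma survivor_set_locally_constant:
  assumes "(beta_map \<beta> \<alpha> ^^ n) t < t" "isCont (beta_map \<beta> \<alpha> ^^ n) t"
  shows "\<forall>\<^sub>F s in nhds t. survivor_set \<beta> \<alpha> s = survivor_set \<beta> \<alpha> t"
proof -
  let ?T = "beta_map \<beta> \<alpha>"
  define m where "m = ((?T ^^ n) t + t) / 2"
  have m: "(?T ^^ n) t < m" "m < t" using assms(1) by (auto simp: m_def field_simps)
  have "\<forall>\<^sub>F s in nhds t. (?T ^^ n) s < m"
    using assms(2) m(1) by (metis isCont_def order_tendstoD(2) tendsto_nhds_iff)
  then obtain e where e: "e > 0" "\<And>s. dist s t < e \<Longrightarrow> (?T ^^ n) s < m"
    unfolding eventually_nhds_metric by blast
  \<comment> \<open>Points of \<open>[a, b)\<close> are within \<open>e\<close> of \<open>t\<close>,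
    so \<open>n\<close> further steps take them below \<open>m\<close>. Since
    \<open>m \<le> a\<close>, survival at threshold \<open>a\<close> forbids visiting
    \<open>[a, b)\<close>.\<close>
  define a where "a = max m (t - e / 2)"
  define b where "b = t + e / 2"
  have ab: "a < t" "t < b" using e m by (auto simp: a_def b_def)
  have "survivor_set \<beta> \<alpha> a \<subseteq> survivor_set \<beta> \<alpha> b"
  proof
    fix x assume x: "x \<in> survivor_set \<beta> \<alpha> a"
    have "b \<le> (?T ^^ k) x" for k
    proof (rule ccontr)
      assume "\<not> ?thesis"
      moreover have "a \<le> (?T ^^ k) x" using x by (auto simp: survivor_set_iff)
      ultimately have "dist ((?T ^^ k) x) t < e"
        using e by (auto simp: a_def b_def dist_real_def)
      then have "(?T ^^ (n + k)) x < m" using e(2) by (simp add: funpow_add)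
      moreover have "a \<le> (?T ^^ (n + k)) x" using x by (auto simp: survivor_set_iff)
      ultimately show False by (simp add: a_def)
    qed
    with x show "x \<in> survivor_set \<beta> \<alpha> b" by (simp add: survivor_set_iff)
  qed
  \<comment> \<open>Survivor sets shrink as the threshold grows, so those for thresholds between
    \<open>a\<close> and \<open>b\<close> are squeezed between two equal sets.\<close>
  then have "survivor_set \<beta> \<alpha> s = survivor_set \<beta> \<alpha> t" if "a < s" "s < b" for s
    using survivor_set_antimono[of a s \<beta> \<alpha>] survivor_set_antimono[of s b \<beta> \<alpha>]
      survivor_set_antimono[of a t \<beta> \<alpha>] survivor_set_antimono[of t b \<beta> \<alpha>] that ab by auto
  moreover have "\<forall>\<^sub>F s in nhds t. s \<in> {a<..<b}"
    using ab by (intro eventually_nhds_in_open) auto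
  ultimately show ?thesis by (auto elim: eventually_mono)
qed

text \<open>Splitting off the first point of the orbit is what lets measure estimates be pulled back
  through the map.\<close>

lemma survivor_set_Suc_iff:
  "x \<in> survivor_set \<beta> \<alpha> t \<longleftrightarrow> x \<in> {0..<1} \<and> t \<le> x \<and> beta_map \<beta> \<alpha> x \<in> survivor_set \<beta> \<alpha> t"
proof -
  have "(\<forall>n. t \<le> (beta_map \<beta> \<alpha> ^^ n) x) \<longleftrightarrow>
      t \<le> x \<and> (\<forall>n. t \<le> (beta_map \<beta> \<alpha> ^^ n) (beta_map \<beta> \<alpha> x))"
    by (metis (no_types, lifting) funpow_0 funpow_simps_right(2) comp_apply not0_implies_Suc)
  then show ?thesis by (auto simp: survivor_set_iff beta_map_bounds)
qed

section \<open>Lebesgue measure on intervals and under affine maps\<close>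

lemma fmeasurable_Ico [simp]: "{a..<b::real} \<in> fmeasurable lborel"
  using fmeasurable_cbox[of a b] by (rule fmeasurableI2) auto

text \<open>Change of variables: an affine map of slope \<open>\<beta>\<close> stretches Lebesgue
  measure by \<open>\<beta>\<close>. Both branches of the map have this form.\<close>

lemma measure_affine_vimage:
  fixes \<beta> \<gamma> a b :: real
  assumes "A \<in> sets borel" "0 < \<beta>"
  shows "measure lborel {x \<in> {a..<b}. \<beta> * x + \<gamma> \<in> A} =
    measure lborel (A \<inter> {\<beta> * a + \<gamma>..<\<beta> * b + \<gamma>}) / \<beta>"
proof -
  let ?B = "A \<inter> {\<beta> * a + \<gamma>..<\<beta> * b + \<gamma>}"
  have B: "?B \<in> sets borel" using assms by simp
  have "emeasure lborel ?B =
      emeasure (density (distr lborel borel (\<lambda>x. \<gamma> + \<beta> * x)) (\<lambda>_. ennreal \<bar>\<beta>\<bar>)) ?B"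
    using lborel_real_affine[of \<beta> \<gamma>] assms by simp
  also have "\<dots> = ennreal \<beta> * emeasure lborel ((\<lambda>x. \<gamma> + \<beta> * x) -` ?B)"
    using assms B by (simp add: emeasure_density nn_integral_cmult_indicator emeasure_distr)
  also have "(\<lambda>x. \<gamma> + \<beta> * x) -` ?B = {x \<in> {a..<b}. \<beta> * x + \<gamma> \<in> A}"
    using assms by (auto simp: add.commute)
  finally show ?thesis
    using assms by (simp add: measure_def enn2real_mult)
qed

lemma measure_split_interval:
  fixes a b m :: real
  assumes "a \<le> m" "m \<le> b" "A \<in> sets borel"
  shows "measure lborel (A \<inter> {a..<b}) =
    measure lborel (A \<inter> {a..<m}) + measure lborel (A \<inter> {m..<b})"
proof -
  have fin: "emeasure lborel (A \<inter> {c..<d}) \<noteq> \<infinity>" for c d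
    using fmeasurable_Int_fmeasurable[OF fmeasurable_Ico[of c d], of A] assms
    by (auto simp: fmeasurable_def Int_commute)
  have "A \<inter> {a..<b} = (A \<inter> {a..<m}) \<union> (A \<inter> {m..<b})" using assms by auto
  then show ?thesis using assms fin by (auto intro!: measure_Union)
qed

section \<open>Continuity of the iterates\<close>

lemma isCont_beta_map:
  assumes "beta_map \<beta> \<alpha> x \<noteq> 0"
  shows "isCont (beta_map \<beta> \<alpha>) x"
proof -
  \<comment> \<open>\<open>frac\<close> jumps only at integers, and these are exactly its zeros;
    hence an orbit avoiding 0 meets no discontinuity.\<close>
  have "isCont frac (\<beta> * x + \<alpha>)"
    using assms by (intro continuous_frac) (simp add: beta_map_def)
  then have "isCont (\<lambda>x. frac (\<beta> * x + \<alpha>)) x"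
    by (rule isCont_o2[rotated]) (intro continuous_intros)
  then show ?thesis by (simp add: beta_map_def[abs_def])
qed

lemma isCont_funpow_beta_map:
  assumes "\<And>k. (beta_map \<beta> \<alpha> ^^ k) x \<noteq> 0"
  shows "isCont (beta_map \<beta> \<alpha> ^^ n) x"
proof (induction n)
  case (Suc n)
  have "isCont (beta_map \<beta> \<alpha>) ((beta_map \<beta> \<alpha> ^^ n) x)"
    using assms[of "Suc n"] by (intro isCont_beta_map) simp
  with Suc show ?case unfolding funpow.simps by (rule continuous_at_compose)
qed (simp add: id_def)

section \<open>The two affine branches of the map\<close>

context
  fixes \<beta> \<alpha> :: real
  assumes Delta: "(\<beta>, \<alpha>) \<in> Delta"
begin

text \<open>The point where \<open>\<beta> * x + \<alpha>\<close> reaches 1, which separates the two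
  branches.\<close>

abbreviation (input) cut :: real where "cut \<equiv> (1 - \<alpha>) / \<beta>"

lemma Delta_bounds: "1 < \<beta>" "\<beta> < 2" "0 \<le> \<alpha>" "\<alpha> \<le> 2 - \<beta>" "\<alpha> < 1" "\<alpha> + \<beta> \<le> 2"
  using Delta by (auto simp: Delta_def)

lemma cut_bounds: "0 < cut" "cut < 1"
  using Delta_bounds by (auto simp: field_simps)

lemma beta_map_left:
  assumes "0 \<le> x" "x < cut"
  shows "beta_map \<beta> \<alpha> x = \<beta> * x + \<alpha>"
proof -
  have "\<beta> * x + \<alpha> < 1" using assms Delta_bounds by (simp add: field_simps)
  then show ?thesis using assms Delta_bounds by (simp add: beta_map_def frac_eq)
qed

lemma beta_map_right:
  assumes "cut \<le> x" "x < 1"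
  shows "beta_map \<beta> \<alpha> x = \<beta> * x + (\<alpha> - 1)"
proof -
  have "1 \<le> \<beta> * x + \<alpha>" using assms Delta_bounds by (simp add: field_simps)
  \<comment> \<open>Together with \<open>\<alpha> + \<beta> \<le> 2\<close> this keeps
    \<open>\<beta> * x + \<alpha>\<close> below 2, so there is no third branch.\<close>
  moreover have "\<beta> * x < \<beta>" using assms Delta_bounds by simp
  ultimately have "\<lfloor>\<beta> * x + \<alpha>\<rfloor> = 1" using Delta_bounds by linarith
  then show ?thesis by (simp add: beta_map_def frac_def)
qed

text \<open>The right branch has the repelling fixed point \<open>p \<ge> 1\<close>, so every orbit leaves \<open>[cut, 1)\<close>.\<close>

lemma survivor_set_cut: "survivor_set \<beta> \<alpha> cut = {}"
proof (rule ccontr)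
  assume "\<not> ?thesis"
  then obtain x where x: "x \<in> survivor_set \<beta> \<alpha> cut" by blast
  define p where "p = (1 - \<alpha>) / (\<beta> - 1)"
  \<comment> \<open>The inequality \<open>1 \<le> p\<close> is a rewriting of
    \<open>\<alpha> \<le> 2 - \<beta>\<close>.\<close>
  have p: "1 \<le> p" "p * (\<beta> - 1) = 1 - \<alpha>"
    using Delta_bounds by (auto simp: p_def field_simps)
  have orbit: "cut \<le> (beta_map \<beta> \<alpha> ^^ n) x" "(beta_map \<beta> \<alpha> ^^ n) x < 1" for n
    using x funpow_beta_map_bounds[of x n \<beta> \<alpha>] by (auto simp: survivor_set_iff)
  have eq: "p - (beta_map \<beta> \<alpha> ^^ n) x = \<beta> ^ n * (p - x)" for n
  proof (induction n)
    case (Suc n)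
    have "p - (beta_map \<beta> \<alpha> ^^ Suc n) x = \<beta> * (p - (beta_map \<beta> \<alpha> ^^ n) x)"
      using beta_map_right[OF orbit(1)[of n] orbit(2)[of n]] p(2) by (simp add: algebra_simps)
    with Suc show ?case by simp
  qed simp
  \<comment> \<open>The distance to \<open>p\<close> grows like \<open>\<beta> ^ n\<close>; once it
    exceeds \<open>p\<close>, the orbit would be negative.\<close>
  have "0 < p - x" using orbit[of 0] p by simp
  moreover obtain n where "p / (p - x) < \<beta> ^ n"
    using real_arch_pow Delta_bounds by blast
  ultimately have "p < \<beta> ^ n * (p - x)" by (simp add: field_simps)
  then show False using eq[of n] orbit(1)[of n] cut_bounds by linarith
qed


section \<open>Measure estimates for survivor sets\<close>

lemma measure_left_branch:
  assumes "0 \<le> a" "b \<le> cut" "A \<in> sets borel"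
  shows "measure lborel {x \<in> {a..<b}. beta_map \<beta> \<alpha> x \<in> A} =
    measure lborel (A \<inter> {\<beta> * a + \<alpha>..<\<beta> * b + \<alpha>}) / \<beta>"
proof -
  have "{x \<in> {a..<b}. beta_map \<beta> \<alpha> x \<in> A} = {x \<in> {a..<b}. \<beta> * x + \<alpha> \<in> A}"
    using assms beta_map_left by auto
  then show ?thesis using measure_affine_vimage[of A \<beta>] assms Delta_bounds by simp
qed

lemma measure_right_branch:
  assumes "cut \<le> a" "b \<le> 1" "A \<in> sets borel"
  shows "measure lborel {x \<in> {a..<b}. beta_map \<beta> \<alpha> x \<in> A} =
    measure lborel (A \<inter> {\<beta> * a + (\<alpha> - 1)..<\<beta> * b + (\<alpha> - 1)}) / \<beta>"
proof -
  have "{x \<in> {a..<b}. beta_map \<beta> \<alpha> x \<in> A} = {x \<in> {a..<b}. \<beta> * x + (\<alpha> - 1) \<in> A}"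
    using assms beta_map_right by auto
  then show ?thesis using measure_affine_vimage[of A \<beta>] assms Delta_bounds by simp
qed

text \<open>Keeps the image of an interval inside the unit interval, as the induction hypotheses
  below require.\<close>

lemma left_branch_bounds:
  assumes "0 \<le> a" "b \<le> cut"
  shows "0 \<le> \<beta> * a + \<alpha>" "\<beta> * b + \<alpha> \<le> 1"
  using assms Delta_bounds by (auto simp: field_simps)

lemma right_branch_bounds:
  assumes "cut \<le> a" "b \<le> 1"
  shows "0 \<le> \<beta> * a + (\<alpha> - 1)" "\<beta> * b + (\<alpha> - 1) \<le> 1"
proof -
  show "0 \<le> \<beta> * a + (\<alpha> - 1)" using assms Delta_bounds by (auto simp: field_simps)
  have "\<beta> * b \<le> \<beta>" using assms Delta_bounds by simp
  then show "\<beta> * b + (\<alpha> - 1) \<le> 1" using Delta_bounds by linarith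
qed

text \<open>An interval straddling the cut is split there: its right part is mapped onto an initial
  interval \<open>[0, u)\<close>, of which a proportion of at least \<open>s\<close> lies in the hole \<open>[0, s)\<close>, and its left
  part is blown up by the factor \<open>\<beta>\<close>, which can happen only finitely often.\<close>

lemma survivor_set_density_aux:
  assumes s: "0 \<le> s" "s \<le> 1"
  shows "0 \<le> a \<Longrightarrow> a \<le> b \<Longrightarrow> b \<le> 1 \<Longrightarrow>
    measure lborel (survivor_set \<beta> \<alpha> s \<inter> {a..<b}) \<le> (1 - s) * (b - a) + s / \<beta> ^ n"
proof (induction n arbitrary: a b)
  case 0
  have "measure lborel (survivor_set \<beta> \<alpha> s \<inter> {a..<b}) \<le> measure lborel {a..<b}"
    by (intro measure_mono_fmeasurable) auto
  also have "\<dots> = (1 - s) * (b - a) + s * (b - a)" using 0 by (simp add: algebra_simps)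
  \<comment> \<open>At \<open>n = 0\<close> the error term is all of \<open>s\<close>, so the
    trivial bound by the length fits.\<close>
  also have "s * (b - a) \<le> s" using 0 s by (simp add: mult_left_le)
  finally show ?case by simp
next
  case (Suc n)
  let ?K = "survivor_set \<beta> \<alpha> s"
  have sub: "measure lborel (?K \<inter> {a..<b}) \<le> measure lborel {x \<in> {a..<b}. beta_map \<beta> \<alpha> x \<in> A}"
    if "?K \<subseteq> A" "A \<in> sets borel" for a b A
  proof (rule measure_mono_fmeasurable)
    show "?K \<inter> {a..<b} \<subseteq> {x \<in> {a..<b}. beta_map \<beta> \<alpha> x \<in> A}"
      using that survivor_set_Suc_iff by blast
    have "{a..<b} \<inter> beta_map \<beta> \<alpha> -` A \<in> sets borel"
      using that measurable_sets[OF measurable_beta_map, of A \<beta> \<alpha>] by simp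
    then show "{x \<in> {a..<b}. beta_map \<beta> \<alpha> x \<in> A} \<in> fmeasurable lborel"
      by (intro fmeasurableI2[OF fmeasurable_Ico[of a b]]) (auto simp: vimage_def Int_def)
  qed auto
  \<comment> \<open>Pulling back along a branch divides by the slope: the length term returns to
    that of \<open>[a, b)\<close>, while the error term gains a factor
    \<open>1 / \<beta>\<close>.\<close>
  have scale: "((1 - s) * ((\<beta> * b + \<gamma>) - (\<beta> * a + \<gamma>)) + s / \<beta> ^ n) / \<beta> =
      (1 - s) * (b - a) + s / \<beta> ^ Suc n" for a b \<gamma>
    using Delta_bounds by (simp add: field_simps)
  have left:
    "measure lborel (?K \<inter> {a..<b}) \<le> (1 - s) * (b - a) + s / \<beta> ^ Suc n"
    if "0 \<le> a" "a \<le> b" "b \<le> cut" for a b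
  proof -
    have "measure lborel (?K \<inter> {a..<b}) \<le>
        measure lborel (?K \<inter> {\<beta> * a + \<alpha>..<\<beta> * b + \<alpha>}) / \<beta>"
      using sub[of ?K a b] measure_left_branch[of a b ?K] that by simp
    also have "\<dots> \<le> ((1 - s) * ((\<beta> * b + \<alpha>) - (\<beta> * a + \<alpha>)) + s / \<beta> ^ n) / \<beta>"
      using that Delta_bounds left_branch_bounds[of a b]
      by (intro divide_right_mono Suc.IH) auto
    finally show ?thesis unfolding scale .
  qed
  have right:
    "measure lborel (?K \<inter> {a..<b}) \<le> (1 - s) * (b - a) + s / \<beta> ^ Suc n"
    if "cut \<le> a" "a \<le> b" "b \<le> 1" for a b
  proof -
    have "measure lborel (?K \<inter> {a..<b}) \<le>
        measure lborel (?K \<inter> {\<beta> * a + (\<alpha> - 1)..<\<beta> * b + (\<alpha> - 1)}) / \<beta>"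
      using sub[of ?K a b] measure_right_branch[of a b ?K] that by simp
    also have "\<dots> \<le>
        ((1 - s) * ((\<beta> * b + (\<alpha> - 1)) - (\<beta> * a + (\<alpha> - 1))) + s / \<beta> ^ n) / \<beta>"
      using that Delta_bounds right_branch_bounds[of a b]
      by (intro divide_right_mono Suc.IH) auto
    finally show ?thesis unfolding scale .
  qed
  consider "b \<le> cut" | "cut \<le> a" | "a \<le> cut" "cut \<le> b" by linarith
  then show ?case
  proof cases
    \<comment> \<open>Applying the induction hypothesis to both halves would double the error. The
      half right of the cut is therefore estimated directly and without error, after a single
      application of the map.\<close>
    case 3
    define u where "u = \<beta> * b + (\<alpha> - 1)"
    have u: "0 \<le> u" "u \<le> 1" "u = \<beta> * (b - cut)" "\<beta> * cut + (\<alpha> - 1) = 0"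
      using right_branch_bounds[of b b] 3 Suc.prems Delta_bounds
      by (auto simp: u_def field_simps)
    have "?K \<subseteq> {s..<1}" by (auto simp: survivor_set_iff) (metis funpow_0)
    then have "measure lborel (?K \<inter> {cut..<b}) \<le> measure lborel ({s..<1} \<inter> {0..<u}) / \<beta>"
      using sub[of "{s..<1}" cut b] measure_right_branch[of cut b "{s..<1}"] 3 Suc.prems u(4)
      by (simp add: u_def)
    also have "{s..<1} \<inter> {0..<u} = {s..<u}" using s u by auto
    \<comment> \<open>If \<open>s \<le> u\<close>, this reads \<open>u - s \<le> u - s * u\<close>,
      true because \<open>u \<le> 1\<close>; otherwise the interval is empty.\<close>
    also have "measure lborel {s..<u} \<le> (1 - s) * u"
      using s u(1,2) mult_left_le[of u s] mult_right_mono[of s 1 u]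
      by (cases "s \<le> u") (auto simp: algebra_simps)
    also have "(1 - s) * u / \<beta> = (1 - s) * (b - cut)" using u Delta_bounds by simp
    finally have "measure lborel (?K \<inter> {cut..<b}) \<le> (1 - s) * (b - cut)"
      using Delta_bounds by (simp add: divide_right_mono)
    with left[of a cut] 3 Suc.prems show ?thesis
      by (subst measure_split_interval[of a cut b]) (auto simp: algebra_simps)
  qed (use left right Suc.prems in auto)
qed

text \<open>The error term \<open>s / \<beta> ^ n\<close> disappears as \<open>n\<close> grows,
  because \<open>\<beta> > 1\<close>.\<close>

lemma survivor_set_density:
  assumes "0 \<le> s" "s \<le> 1" "0 \<le> a" "a \<le> b" "b \<le> 1"
  shows "measure lborel (survivor_set \<beta> \<alpha> s \<inter> {a..<b}) \<le> (1 - s) * (b - a)"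
proof (rule tendsto_lowerbound)
  have "(\<lambda>n. (1 - s) * (b - a) + s / \<beta> ^ n) \<longlonglongrightarrow> (1 - s) * (b - a) + 0"
    using Delta_bounds by (intro tendsto_intros LIMSEQ_divide_realpow_zero) auto
  then show "(\<lambda>n. (1 - s) * (b - a) + s / \<beta> ^ n) \<longlonglongrightarrow> (1 - s) * (b - a)" by simp
qed (use survivor_set_density_aux[OF assms(1,2)] assms in auto)

text \<open>The bound \<open>k < n\<close> makes \<open>n = 0\<close> impose no condition, so
  inductions start from the whole unit interval.\<close>

definition finite_survivors :: "real \<Rightarrow> nat \<Rightarrow> real set" where
  "finite_survivors s n = {x \<in> {0..<1}. \<forall>k<n. s \<le> (beta_map \<beta> \<alpha> ^^ k) x}"

lemma finite_survivors_Suc_iff: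
  "x \<in> finite_survivors s (Suc n) \<longleftrightarrow>
    x \<in> {0..<1} \<and> s \<le> x \<and> beta_map \<beta> \<alpha> x \<in> finite_survivors s n"
  unfolding finite_survivors_def
  by (auto simp: All_less_Suc2 beta_map_bounds funpow_swap1)

lemma sets_finite_survivors [measurable]: "finite_survivors s n \<in> sets borel"
proof -
  have "finite_survivors s n = {0..<1} \<inter> {x. \<forall>k<n. s \<le> (beta_map \<beta> \<alpha> ^^ k) x}"
    by (auto simp: finite_survivors_def)
  also have "\<dots> \<in> sets borel" by measurable
  finally show ?thesis .
qed

lemma INT_finite_survivors: "(\<Inter>n. finite_survivors s n) = survivor_set \<beta> \<alpha> s"
  by (auto simp: finite_survivors_def survivor_set_iff) blast

text \<open>The density bound passes from intervals to the sets \<open>finite_survivors s n\<close>, which are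
  finite unions of intervals shrinking to the survivor set.\<close>

lemma survivor_set_density_finite_survivors:
  assumes s: "0 \<le> s" "s \<le> 1"
  shows "0 \<le> a \<Longrightarrow> a \<le> b \<Longrightarrow> b \<le> 1 \<Longrightarrow>
    measure lborel (survivor_set \<beta> \<alpha> s \<inter> {a..<b}) \<le>
      (1 - s) * measure lborel (finite_survivors s n \<inter> {a..<b})"
proof (induction n arbitrary: a b)
  case 0
  have "finite_survivors s 0 \<inter> {a..<b} = {a..<b}" using 0 by (auto simp: finite_survivors_def)
  then show ?case using survivor_set_density s 0 by simp
next
  case (Suc n)
  let ?K = "survivor_set \<beta> \<alpha> s" and ?N = "finite_survivors s"
  \<comment> \<open>The condition \<open>s \<le> x\<close> on the starting point only moves the left
    end to \<open>max a s\<close>; after that both sets are preimages over one common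
    interval.\<close>
  have eq: "?K \<inter> {a..<b} = {x \<in> {max a s..<b}. beta_map \<beta> \<alpha> x \<in> ?K}"
      "?N (Suc n) \<inter> {a..<b} = {x \<in> {max a s..<b}. beta_map \<beta> \<alpha> x \<in> ?N n}"
    if "0 \<le> a" "b \<le> 1" for a b
  proof -
    have "x \<in> ?K \<inter> {a..<b} \<longleftrightarrow> x \<in> {x \<in> {max a s..<b}. beta_map \<beta> \<alpha> x \<in> ?K}" for x
      using that survivor_set_Suc_iff[of x \<beta> \<alpha> s] by auto
    then show "?K \<inter> {a..<b} = {x \<in> {max a s..<b}. beta_map \<beta> \<alpha> x \<in> ?K}" by blast
    show "?N (Suc n) \<inter> {a..<b} = {x \<in> {max a s..<b}. beta_map \<beta> \<alpha> x \<in> ?N n}"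
      using that by (auto simp: finite_survivors_Suc_iff)
  qed
  have left:
    "measure lborel (?K \<inter> {a..<b}) \<le> (1 - s) * measure lborel (?N (Suc n) \<inter> {a..<b})"
    if "0 \<le> a" "a \<le> b" "b \<le> cut" for a b
  proof (cases "max a s \<le> b")
    case True
    have ab: "0 \<le> a" "b \<le> 1" using that cut_bounds by simp_all
    have p: "0 \<le> max a s" using that by simp
    have branch: "measure lborel {x \<in> {max a s..<b}. beta_map \<beta> \<alpha> x \<in> A} =
        measure lborel (A \<inter> {\<beta> * max a s + \<alpha>..<\<beta> * b + \<alpha>}) / \<beta>" if "A \<in> sets borel" for A
      using measure_left_branch[OF p \<open>b \<le> cut\<close> that] .
    \<comment> \<open>Both measures are divided by the same slope, so the proportion
      \<open>1 - s\<close> survives the pullback.\<close>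
    have "measure lborel (?K \<inter> {\<beta> * max a s + \<alpha>..<\<beta> * b + \<alpha>}) / \<beta> \<le>
        (1 - s) * measure lborel (?N n \<inter> {\<beta> * max a s + \<alpha>..<\<beta> * b + \<alpha>}) / \<beta>"
      using left_branch_bounds[OF p \<open>b \<le> cut\<close>] True Delta_bounds
      by (intro divide_right_mono Suc.IH) auto
    then show ?thesis
      unfolding eq[OF ab] branch[OF sets_survivor_set] branch[OF sets_finite_survivors] by simp
  next
    case False
    have "0 \<le> a" "b \<le> 1" using that cut_bounds by simp_all
    from eq(1)[OF this] False have "?K \<inter> {a..<b} = {}" by simp
    then show ?thesis using s by simp
  qed
  have right:
    "measure lborel (?K \<inter> {a..<b}) \<le> (1 - s) * measure lborel (?N (Suc n) \<inter> {a..<b})"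
    if "cut \<le> a" "a \<le> b" "b \<le> 1" for a b
  proof (cases "max a s \<le> b")
    case True
    have ab: "0 \<le> a" "b \<le> 1" using that cut_bounds by simp_all
    have p: "cut \<le> max a s" using that by simp
    have branch: "measure lborel {x \<in> {max a s..<b}. beta_map \<beta> \<alpha> x \<in> A} =
        measure lborel (A \<inter> {\<beta> * max a s + (\<alpha> - 1)..<\<beta> * b + (\<alpha> - 1)}) / \<beta>" if "A \<in> sets borel" for A
      using measure_right_branch[OF p \<open>b \<le> 1\<close> that] .
    have "measure lborel (?K \<inter> {\<beta> * max a s + (\<alpha> - 1)..<\<beta> * b + (\<alpha> - 1)}) / \<beta> \<le>
        (1 - s) * measure lborel (?N n \<inter> {\<beta> * max a s + (\<alpha> - 1)..<\<beta> * b + (\<alpha> - 1)}) / \<beta>"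
      using right_branch_bounds[OF p \<open>b \<le> 1\<close>] True Delta_bounds
      by (intro divide_right_mono Suc.IH) auto
    then show ?thesis
      unfolding eq[OF ab] branch[OF sets_survivor_set] branch[OF sets_finite_survivors] by simp
  next
    case False
    have "0 \<le> a" "b \<le> 1" using that cut_bounds by simp_all
    from eq(1)[OF this] False have "?K \<inter> {a..<b} = {}" by simp
    then show ?thesis using s by simp
  qed
  consider "b \<le> cut" | "cut \<le> a" | "a \<le> cut" "cut \<le> b" by linarith
  then show ?case
  proof cases
    \<comment> \<open>With no error term present, the bounds for the two halves simply add
      up.\<close>
    case 3
    with left[of a cut] right[of cut b] Suc.prems show ?thesis
      by (simp add: measure_split_interval[of a cut b] distrib_left)
  qed (use left right Suc.prems in auto)
qed

text \<open>The sets \<open>finite_survivors s n\<close> decrease to the survivor set, so in the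
  limit its measure is at most \<open>1 - s\<close> times itself. Being finite, that measure must
  vanish.\<close>

lemma survivor_set_null:
  assumes "0 < s" "s \<le> 1"
  shows "survivor_set \<beta> \<alpha> s \<in> null_sets lborel"
proof -
  let ?K = "survivor_set \<beta> \<alpha> s"
  have sub: "finite_survivors s n \<subseteq> {0..<1}" for n by (auto simp: finite_survivors_def)
  have fin: "emeasure lborel A \<noteq> \<infinity>" if "A \<subseteq> {0..<1}" for A :: "real set"
    using emeasure_mono[OF that, of lborel] by (auto simp: top_unique)
  have K: "?K \<subseteq> {0..<1}" by (auto simp: survivor_set_def)
  have "measure lborel ?K \<le> (1 - s) * measure lborel (finite_survivors s n)" for n
    using survivor_set_density_finite_survivors[of s 0 1 n] assms K sub[of n]
    by (simp add: Int_absorb2)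
  moreover have "(\<lambda>n. measure lborel (finite_survivors s n)) \<longlonglongrightarrow>
      measure lborel (\<Inter>n. finite_survivors s n)"
    using fin[OF sub] by (intro Lim_measure_decseq) (auto simp: decseq_def finite_survivors_def)
  ultimately have "measure lborel ?K \<le> (1 - s) * measure lborel ?K"
    unfolding INT_finite_survivors
    by (intro tendsto_lowerbound[OF tendsto_mult_left]) auto
  then have "s * measure lborel ?K \<le> 0" by (simp add: algebra_simps)
  then have "measure lborel ?K = 0"
    using assms measure_nonneg[of lborel ?K] by (auto simp: mult_le_0_iff)
  \<comment> \<open>\<open>measure\<close> is also 0 on sets of infinite \<open>emeasure\<close>;
    containment in the unit interval excludes that case.\<close>
  then show ?thesis
    using fin[OF K] by (auto simp: measure_def enn2real_eq_0_iff intro: null_setsI)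
qed

section \<open>Local constancy almost everywhere\<close>

lemma countable_funpow_beta_map_zeros: "countable {x. (beta_map \<beta> \<alpha> ^^ n) x = 0}"
proof (induction n)
  case (Suc n)
  \<comment> \<open>A value of the map has at most one preimage for each integer part
    \<open>k\<close>, hence countably many.\<close>
  have "{x. (beta_map \<beta> \<alpha> ^^ Suc n) x = 0} \<subseteq>
      (\<Union>k::int. (\<lambda>y. (y + of_int k - \<alpha>) / \<beta>) ` {x. (beta_map \<beta> \<alpha> ^^ n) x = 0})"
  proof
    fix x assume "x \<in> {x. (beta_map \<beta> \<alpha> ^^ Suc n) x = 0}"
    then have "beta_map \<beta> \<alpha> x \<in> {x. (beta_map \<beta> \<alpha> ^^ n) x = 0}" by (simp add: funpow_swap1)
    moreover have "x = (beta_map \<beta> \<alpha> x + of_int \<lfloor>\<beta> * x + \<alpha>\<rfloor> - \<alpha>) / \<beta>"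
      using Delta_bounds by (simp add: beta_map_def frac_def)
    ultimately show "x \<in> (\<Union>k::int. (\<lambda>y. (y + of_int k - \<alpha>) / \<beta>) `
        {x. (beta_map \<beta> \<alpha> ^^ n) x = 0})" by blast
  qed
  then show ?case by (rule countable_subset) (intro countable_UN countable_image Suc countableI_type)
qed simp

lemma AE_locally_constant: "AE t in lebesgue_on {0..1}. locally_constant_at (dim_fun \<beta> \<alpha>) t"
proof -
  \<comment> \<open>The exceptional set: the end points, the points surviving at some positive
    rational threshold, and the points whose orbit meets 0, where an iterate may be discontinuous.
    Rational thresholds keep the union countable.\<close>
  define B where "B = {0, 1} \<union> (\<Union>q\<in>\<rat> \<inter> {0<..1}. survivor_set \<beta> \<alpha> q) \<union>
    (\<Union>n. {x. (beta_map \<beta> \<alpha> ^^ n) x = 0})"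
  have "B \<in> null_sets lborel"
    unfolding B_def
    by (intro null_sets.Un null_sets_UN' countable_imp_null_set_lborel survivor_set_null
        countable_UN countable_funpow_beta_map_zeros countable_Int1 countable_rat) auto
  then have "AE t in lebesgue. t \<notin> B" by (intro AE_completion AE_not_in)
  moreover have "locally_constant_at (dim_fun \<beta> \<alpha>) t" if t: "t \<in> {0..1}" "t \<notin> B" for t
  proof -
    have "0 < t" "t < 1" using t by (auto simp: B_def less_le)
    then obtain q where q: "q \<in> \<rat>" "0 < q" "q < t" using Rats_dense_in_real by blast
    then have "t \<notin> survivor_set \<beta> \<alpha> q" using t by (auto simp: B_def)
    then obtain n where "(beta_map \<beta> \<alpha> ^^ n) t < q"
      using \<open>0 < t\<close> \<open>t < 1\<close> by (auto simp: survivor_set_iff not_le)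
    moreover have "isCont (beta_map \<beta> \<alpha> ^^ n) t"
      using t by (intro isCont_funpow_beta_map) (auto simp: B_def)
    ultimately have "\<forall>\<^sub>F s in nhds t. survivor_set \<beta> \<alpha> s = survivor_set \<beta> \<alpha> t"
      using q by (intro survivor_set_locally_constant) auto
    then show ?thesis
      unfolding eventually_nhds locally_constant_at_def dim_fun_def by (metis IntD1)
  qed
  ultimately show ?thesis by (subst AE_restrict_space_iff) (auto elim: AE_mp)
qed

end

theorem corollary1p4:
  fixes \<beta> \<alpha> :: real
  assumes "(\<beta>, \<alpha>) \<in> Delta"
  shows "dim_fun \<beta> \<alpha> 0 = 1 \<and>
         dim_fun \<beta> \<alpha> ((1 - \<alpha>) / \<beta>) = 0 \<and>
         antimono_on {0..1} (dim_fun \<beta> \<alpha>) \<and>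
         (AE t in lebesgue_on {0..1}. locally_constant_at (dim_fun \<beta> \<alpha>) t)"
proof (intro conjI)
  show "dim_fun \<beta> \<alpha> 0 = 1"
    by (simp add: dim_fun_def survivor_set_zero hausdorff_dim_unit_interval)
  show "dim_fun \<beta> \<alpha> ((1 - \<alpha>) / \<beta>) = 0"
    by (simp add: dim_fun_def survivor_set_cut[OF assms])
  show "antimono_on {0..1} (dim_fun \<beta> \<alpha>)"
    by (auto simp: dim_fun_def monotone_on_def intro!: hausdorff_dim_mono survivor_set_antimono)
  show "AE t in lebesgue_on {0..1}. locally_constant_at (dim_fun \<beta> \<alpha>) t"
    by (rule AE_locally_constant[OF assms])
qed

end
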